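(* Let $G$ and $H$ be local amoebas such that $G$ has a leaf and $H$ is a rooted graph which is hang-symmetric at its root. Assume moreover that $H$ is disconnected. Then the comb product $G*H$ is a local amoeba.
   Context: All graphs are finite and simple; a leaf is a vertex of degree $1$. A labeled graph $G$ comes with a bijection $\lambda:V(G)\to X$ onto a label set $X$; write $v_x=\lambda^{-1}(x)$ and $L_G=\{ij: v_iv_j\in E(G)\}$ (unordered pairs). For $\sigma\in\operatorname{Sym}(X)$, $G_\sigma$ is the graph on $V(G)$ with edge set $\{v_iv_j:\sigma(i)\sigma(j)\in L_G\}$. $\operatorname{Aut}(G)$ is identified with $\{\sigma\in\operatorname{Sym}(X): G_\sigma=G\}$. An edge-replacement $rs\to kl$ removes an edge $v_rv_s\in E(G)$ and adds $v_kv_l\in E(\overline G)\cup\{v_rv_s\}$; it is feasible if $G-v_rv_s+v_kv_l\cong G$. $R_G$ is the set of feasible edge-replacements $rs\to kl$ with $rs\ne kl$ together with the neutral replacement $\emptyset\to\emptyset$ (nothing changes). $\operatorname{Fer}_G(rs\to kl)=\{\sigma\in\operatorname{Sym}(X): G_\sigma=G-v_rv_s+v_kv_l\}$ and $\operatorname{Fer}_G(\emptyset\to\emptyset)=\operatorname{Aut}(G)$. $\mathcal{E}_G$ is the union of the sets $\operatorname{Fer}_G(e\to e')$ over all $e\to e'\in R_G$, and $\operatorname{Fer}(G)=\langle\mathcal{E}_G\rangle\le\operatorname{Sym}(X)$. $G$ is a local amoeba if $\operatorname{Fer}(G)=\operatorname{Sym}(X)$. For $i\in X$, $\mathcal{E}_G^i=\{\sigma\in\mathcal{E}_G:\sigma(i)=i\}$;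 the hang group of $G$ at $i$ is $\mathbf{H}_i(G)=\langle\mathcal{E}_G^i\cup\operatorname{Aut}(G)\rangle$, and $G$ is hang-symmetric at $v_i$ if $\mathbf{H}_i(G)=\operatorname{Sym}(X)$. Comb product: for a graph $G$ and a graph $H$ with root $v$, $G*H$ has vertex set $V(G)\times V(H)$, with an edge between $(u,v)$ and $(u',v)$ for each $uu'\in E(G)$, and an edge between $(u,w)$ and $(u,w')$ for each $u\in V(G)$ and $ww'\in E(H)$. *)

theory Defs
  imports "HOL-Algebra.Bij" "HOL-Algebra.Generated_Groups"
begin

record 'v ugraph =
  verts :: "'v set"
  edges :: "'v set set"

definition simple_graph :: "'v ugraph \<Rightarrow> bool" where
  "simple_graph G \<longleftrightarrow> finite (verts G) \<and>
     (\<forall>e \<in> edges G. \<exists>u \<in> verts G. \<exists>v \<in> verts G. u \<noteq> v \<and> e = {u, v})"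

definition complement_graph :: "'v ugraph \<Rightarrow> 'v ugraph" where
  "complement_graph G =
     \<lparr>verts = verts G,
      edges = {{u, v} | u v. u \<in> verts G \<and> v \<in> verts G \<and> u \<noteq> v \<and> {u, v} \<notin> edges G}\<rparr>"

definition graph_isomorphic :: "'v ugraph \<Rightarrow> 'w ugraph \<Rightarrow> bool" where
  "graph_isomorphic G H \<longleftrightarrow>
     (\<exists>f. bij_betw f (verts G) (verts H) \<and>
        (\<forall>u \<in> verts G. \<forall>v \<in> verts G. {u, v} \<in> edges G \<longleftrightarrow> {f u, f v} \<in> edges H))"

definition degree :: "'v ugraph \<Rightarrow> 'v \<Rightarrow> nat" where
  "degree G v = card {e \<in> edges G. v \<in> e}"

definition leaf :: "'v ugraph \<Rightarrow> 'v \<Rightarrow> bool" where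
  "leaf G v \<longleftrightarrow> v \<in> verts G \<and> degree G v = 1"

definition connected_graph :: "'v ugraph \<Rightarrow> bool" where
  "connected_graph G \<longleftrightarrow>
     (\<forall>u \<in> verts G. \<forall>v \<in> verts G. (u, v) \<in> {(a, b). {a, b} \<in> edges G}\<^sup>*)"

definition comb_product :: "'v ugraph \<Rightarrow> 'w ugraph \<Rightarrow> 'w \<Rightarrow> ('v \<times> 'w) ugraph" where
  "comb_product G H v =
     \<lparr>verts = verts G \<times> verts H,
      edges = {{(u, v), (u', v)} | u u'. {u, u'} \<in> edges G}
            \<union> {{(u, w), (u, w')} | u w w'. u \<in> verts G \<and> {w, w'} \<in> edges H}\<rparr>"

lemma simple_graph_comb_product:
  assumes "simple_graph G" "simple_graph H" "v \<in> verts H"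
  shows "simple_graph (comb_product G H v)"
  unfolding simple_graph_def
proof (intro conjI ballI)
  show "finite (verts (comb_product G H v))"
    using assms by (simp add: simple_graph_def comb_product_def)
next
  fix e assume "e \<in> edges (comb_product G H v)"
  then consider (base) u u' where "e = {(u, v), (u', v)}" "{u, u'} \<in> edges G"
    | (fibre) u w w' where "e = {(u, w), (u, w')}" "u \<in> verts G" "{w, w'} \<in> edges H"
    by (auto simp: comb_product_def)
  then show "\<exists>p\<in>verts (comb_product G H v). \<exists>q\<in>verts (comb_product G H v). p \<noteq> q \<and> e = {p, q}"
  proof cases
    case base
    then have "u \<in> verts G" "u' \<in> verts G" "u \<noteq> u'"
      using assms(1) unfolding simple_graph_def by (force simp: doubleton_eq_iff)+
    then show ?thesis using base assms(3)
      by (intro bexI[of _ "(u, v)"] bexI[of _ "(u', v)"]) (auto simp: comb_product_def)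
  next
    case fibre
    then have "w \<in> verts H" "w' \<in> verts H" "w \<noteq> w'"
      using assms(2) unfolding simple_graph_def by (force simp: doubleton_eq_iff)+
    then show ?thesis using fibre
      by (intro bexI[of _ "(u, w)"] bexI[of _ "(u, w')"]) (auto simp: comb_product_def)
  qed
qed

text \<open>A labeled graph is given by a graph \<open>G\<close>, a label set \<open>X\<close> and a labeling \<open>lam\<close>,
  passed as separate arguments. \<open>Sym(X)\<close> is the library's \<^const>\<open>BijGroup\<close>, whose elements
  are functions that are \<^const>\<open>undefined\<close> outside \<open>X\<close>.\<close>

definition labeled_graph :: "'v ugraph \<Rightarrow> 'x set \<Rightarrow> ('v \<Rightarrow> 'x) \<Rightarrow> bool" where
  "labeled_graph G X lam \<longleftrightarrow> simple_graph G \<and> bij_betw lam (verts G) X"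

definition vtx :: "'v ugraph \<Rightarrow> ('v \<Rightarrow> 'x) \<Rightarrow> 'x \<Rightarrow> 'v" where
  "vtx G lam x = the_inv_into (verts G) lam x"

definition label_edges :: "'v ugraph \<Rightarrow> 'x set \<Rightarrow> ('v \<Rightarrow> 'x) \<Rightarrow> 'x set set" where
  "label_edges G X lam =
     {{i, j} | i j. i \<in> X \<and> j \<in> X \<and> {vtx G lam i, vtx G lam j} \<in> edges G}"

definition permuted_graph :: "'v ugraph \<Rightarrow> 'x set \<Rightarrow> ('v \<Rightarrow> 'x) \<Rightarrow> ('x \<Rightarrow> 'x) \<Rightarrow> 'v ugraph" where
  "permuted_graph G X lam \<sigma> =
     \<lparr>verts = verts G,
      edges = {{vtx G lam i, vtx G lam j} | i j.
                 i \<in> X \<and> j \<in> X \<and> {\<sigma> i, \<sigma> j} \<in> label_edges G X lam}\<rparr>"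

definition Aut :: "'v ugraph \<Rightarrow> 'x set \<Rightarrow> ('v \<Rightarrow> 'x) \<Rightarrow> ('x \<Rightarrow> 'x) set" where
  "Aut G X lam = {\<sigma> \<in> carrier (BijGroup X). permuted_graph G X lam \<sigma> = G}"

text \<open>\<open>Replace e e'\<close> is the edge-replacement \<open>rs \<rightarrow> kl\<close> for the unordered pairs of labels
  \<open>e = {r, s}\<close>, \<open>e' = {k, l}\<close>; \<open>Neutral\<close> is \<open>\<emptyset> \<rightarrow> \<emptyset>\<close>.\<close>

datatype 'x replacement = Neutral | Replace "'x set" "'x set"

definition replace_edge :: "'v ugraph \<Rightarrow> ('v \<Rightarrow> 'x) \<Rightarrow> 'x set \<Rightarrow> 'x set \<Rightarrow> 'v ugraph" where
  "replace_edge G lam e e' =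
     \<lparr>verts = verts G, edges = (edges G - {vtx G lam ` e}) \<union> {vtx G lam ` e'}\<rparr>"

definition edge_replacement ::
    "'v ugraph \<Rightarrow> 'x set \<Rightarrow> ('v \<Rightarrow> 'x) \<Rightarrow> 'x set \<Rightarrow> 'x set \<Rightarrow> bool" where
  "edge_replacement G X lam e e' \<longleftrightarrow>
     e \<in> label_edges G X lam \<and> e' \<in> label_edges (complement_graph G) X lam \<union> {e}"

definition feasible ::
    "'v ugraph \<Rightarrow> 'x set \<Rightarrow> ('v \<Rightarrow> 'x) \<Rightarrow> 'x set \<Rightarrow> 'x set \<Rightarrow> bool" where
  "feasible G X lam e e' \<longleftrightarrow>
     edge_replacement G X lam e e' \<and> graph_isomorphic (replace_edge G lam e e') G"

definition feasible_replacements ::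
    "'v ugraph \<Rightarrow> 'x set \<Rightarrow> ('v \<Rightarrow> 'x) \<Rightarrow> 'x replacement set" where
  "feasible_replacements G X lam =
     {Replace e e' | e e'. feasible G X lam e e' \<and> e \<noteq> e'} \<union> {Neutral}"

fun Fer_perms ::
    "'v ugraph \<Rightarrow> 'x set \<Rightarrow> ('v \<Rightarrow> 'x) \<Rightarrow> 'x replacement \<Rightarrow> ('x \<Rightarrow> 'x) set" where
  "Fer_perms G X lam (Replace e e') =
     {\<sigma> \<in> carrier (BijGroup X). permuted_graph G X lam \<sigma> = replace_edge G lam e e'}"
| "Fer_perms G X lam Neutral = Aut G X lam"

definition all_Fer_perms :: "'v ugraph \<Rightarrow> 'x set \<Rightarrow> ('v \<Rightarrow> 'x) \<Rightarrow> ('x \<Rightarrow> 'x) set" where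
  "all_Fer_perms G X lam = (\<Union>\<rho> \<in> feasible_replacements G X lam. Fer_perms G X lam \<rho>)"

definition Fer_group :: "'v ugraph \<Rightarrow> 'x set \<Rightarrow> ('v \<Rightarrow> 'x) \<Rightarrow> ('x \<Rightarrow> 'x) set" where
  "Fer_group G X lam = generate (BijGroup X) (all_Fer_perms G X lam)"

definition local_amoeba :: "'v ugraph \<Rightarrow> 'x set \<Rightarrow> ('v \<Rightarrow> 'x) \<Rightarrow> bool" where
  "local_amoeba G X lam \<longleftrightarrow> Fer_group G X lam = carrier (BijGroup X)"

definition hang_group :: "'v ugraph \<Rightarrow> 'x set \<Rightarrow> ('v \<Rightarrow> 'x) \<Rightarrow> 'x \<Rightarrow> ('x \<Rightarrow> 'x) set" where
  "hang_group G X lam i =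
     generate (BijGroup X) ({\<sigma> \<in> all_Fer_perms G X lam. \<sigma> i = i} \<union> Aut G X lam)"

definition hang_symmetric_at :: "'v ugraph \<Rightarrow> 'x set \<Rightarrow> ('v \<Rightarrow> 'x) \<Rightarrow> 'v \<Rightarrow> bool" where
  "hang_symmetric_at G X lam v \<longleftrightarrow> hang_group G X lam (lam v) = carrier (BijGroup X)"

end

theory Submission
  imports Defs "HOL-Combinatorics.Permutations"
begin

text \<open>
  The permutations in \<open>\<E>\<^sub>G\<close> are those that map all edges but at most one to edges.
  If \<open>u\<close> is a leaf of \<open>G\<close>, the generators of the hang group of \<open>H\<close> act on the fibre
  over \<open>u\<close> as elements of \<open>\<E>\<close> of the comb product, because only one base edge touches that fibre.
  So the full symmetric group of this fibre lies in \<open>Fer (G * H)\<close>, and conjugation by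
  \<open>Fer G\<close>, which acts on the first coordinate, gives the same for every fibre.
  As \<open>H\<close> is disconnected, exchanging the vertices of two fibres that are not reachable from the
  root is an automorphism of \<open>G * H\<close>. It separates such a vertex from the root of its
  fibre, so it conjugates a transposition within one fibre to a transposition across two fibres,
  and the transpositions obtained generate everything.
\<close>

unbundle no m_inv_syntax

section \<open>The symmetric group on the vertices\<close>

text \<open>Elements are total functions that fix every point outside \<open>V\<close>, unlike those
  of \<open>BijGroup\<close>. Multiplication is thus plain composition, and the theory of
  \<open>permutes\<close> and \<open>transpose\<close> applies.\<close>

definition perm_group :: "'a set \<Rightarrow> ('a \<Rightarrow> 'a) monoid" where
  "perm_group V = \<lparr>carrier = {p. p permutes V}, monoid.mult = (\<circ>), one = id\<rparr>"

lemma perm_group_simps [simp]: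
  "carrier (perm_group V) = {p. p permutes V}"
  "x \<otimes>\<^bsub>perm_group V\<^esub> y = x \<circ> y"
  "\<one>\<^bsub>perm_group V\<^esub> = id"
  by (simp_all add: perm_group_def)

lemma group_perm_group: "group (perm_group V)"
proof (rule groupI)
  fix p assume "p \<in> carrier (perm_group V)"
  then show "\<exists>q\<in>carrier (perm_group V). q \<otimes>\<^bsub>perm_group V\<^esub> p = \<one>\<^bsub>perm_group V\<^esub>"
    by (intro bexI[of _ "inv p"]) (auto simp: permutes_inv_o permutes_inv)
qed (auto simp: permutes_compose permutes_id comp_assoc)

lemma inv_perm_group: "p permutes V \<Longrightarrow> m_inv (perm_group V) p = inv p"
  by (rule group.inv_equality[OF group_perm_group]) (auto simp: permutes_inv_o permutes_inv)

lemma subgroup_comp_closed: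
  "subgroup K (perm_group V) \<Longrightarrow> p \<in> K \<Longrightarrow> q \<in> K \<Longrightarrow> p \<circ> q \<in> K"
  using subgroup.m_closed[of K "perm_group V" p q] by (simp only: perm_group_simps)

text \<open>Conjugation by \<open>g\<close> moves both points of a transposition by
  \<open>g\<close>. This is how a known transposition is carried to other fibres.\<close>

lemma transpose_conjugate_mem:
  assumes "subgroup K (perm_group V)" "g \<in> K" "transpose a b \<in> K"
  shows "transpose (g a) (g b) \<in> K"
proof -
  have g: "g permutes V"
    using subgroup.mem_carrier[OF assms(1,2)] by simp
  have "g \<circ> transpose a b \<circ> inv g = transpose (g a) (g b)"
    using transpose_comp_eq[OF permutes_bij[OF g], of "g a" "g b"]
    by (simp add: permutes_inverses[OF g]) (metis comp_assoc comp_id permutes_inv_o(1)[OF g])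
  moreover have "inv g \<in> K"
    using subgroup.m_inv_closed[OF assms(1,2)] by (simp add: inv_perm_group[OF g])
  ultimately show ?thesis
    using subgroup_comp_closed[OF assms(1)] assms(2,3) by metis
qed

lemma transpose_trans_mem:
  assumes "subgroup K (perm_group V)" "transpose a b \<in> K" "transpose b c \<in> K"
  shows "transpose a c \<in> K"
proof (cases "a = b \<or> a = c")
  case True
  then show ?thesis
    using assms(3) subgroup.one_closed[OF assms(1)] by auto
next
  case False
  \<comment> \<open>Here \<open>transpose b c\<close> is the conjugating element: it fixes
    \<open>a\<close> and sends \<open>b\<close> to \<open>c\<close>.\<close>
  then show ?thesis
    using transpose_conjugate_mem[OF assms(1,3,2)] by simp
qed

lemma perm_group_subgroup_eq_carrier:
  assumes "subgroup K (perm_group V)" "finite V"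
    and "\<And>a b. a \<in> V \<Longrightarrow> b \<in> V \<Longrightarrow> transpose a b \<in> K"
  shows "K = carrier (perm_group V)"
proof
  show "carrier (perm_group V) \<subseteq> K"
  proof
    fix p assume "p \<in> carrier (perm_group V)"
    then have "p permutes V" by simp
    then show "p \<in> K" using assms(2)
    proof (induction rule: permutes_induct)
      case id
      show ?case using subgroup.one_closed[OF assms(1)] by (simp only: perm_group_simps)
    next
      case (swap a b p)
      then show ?case using subgroup_comp_closed[OF assms(1) assms(3)] by blast
    qed
  qed
qed (rule subgroup.subset[OF assms(1)])


section \<open>Local amoebas in terms of vertex permutations\<close>

text \<open>Only one direction is required: on a finite edge set, an injection into itself is
  onto.\<close>

definition automorphism :: "'v ugraph \<Rightarrow> ('v \<Rightarrow> 'v) \<Rightarrow> bool" where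
  "automorphism G p \<longleftrightarrow> p permutes verts G \<and> (\<forall>e \<in> edges G. p ` e \<in> edges G)"

text \<open>The vertex form of membership in \<open>all_Fer_perms\<close>. The exception
  \<open>f\<close> may be any set, so automorphisms are included; the added edge is not recorded
  because counting recovers it.\<close>

definition near_automorphism :: "'v ugraph \<Rightarrow> ('v \<Rightarrow> 'v) \<Rightarrow> bool" where
  "near_automorphism G p \<longleftrightarrow>
     p permutes verts G \<and> (\<exists>f. \<forall>e \<in> edges G. e \<noteq> f \<longrightarrow> p ` e \<in> edges G)"

definition relabel :: "'v ugraph \<Rightarrow> 'x set \<Rightarrow> ('v \<Rightarrow> 'x) \<Rightarrow> ('v \<Rightarrow> 'v) \<Rightarrow> 'x \<Rightarrow> 'x" where
  "relabel G X lam p = (\<lambda>x\<in>X. lam (p (vtx G lam x)))"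

lemma automorphism_imp_near: "automorphism G p \<Longrightarrow> near_automorphism G p"
  by (auto simp: automorphism_def near_automorphism_def)

section \<open>Edges, labels, and the isomorphism from vertex permutations to label
  permutations\<close>

lemma edgeE:
  assumes "simple_graph G" "e \<in> edges G"
  obtains u v where "u \<in> verts G" "v \<in> verts G" "u \<noteq> v" "e = {u, v}"
  using assms by (auto simp: simple_graph_def)

lemma edge_verts: "simple_graph G \<Longrightarrow> e \<in> edges G \<Longrightarrow> e \<subseteq> verts G"
  by (auto simp: simple_graph_def)

lemma finite_edges: "simple_graph G \<Longrightarrow> finite (edges G)"
  by (rule finite_subset[of _ "Pow (verts G)"]) (auto simp: simple_graph_def)

lemma vtx_lam: "bij_betw lam (verts G) X \<Longrightarrow> v \<in> verts G \<Longrightarrow> vtx G lam (lam v) = v"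
  by (simp add: vtx_def bij_betw_def the_inv_into_f_f)

lemma lam_vtx: "bij_betw lam (verts G) X \<Longrightarrow> x \<in> X \<Longrightarrow> lam (vtx G lam x) = x"
  by (simp add: vtx_def f_the_inv_into_f_bij_betw)

lemma bij_betw_vtx: "bij_betw lam (verts G) X \<Longrightarrow> bij_betw (vtx G lam) X (verts G)"
  unfolding vtx_def[abs_def] by (rule bij_betw_the_inv_into)

lemma vtx_mem: "bij_betw lam (verts G) X \<Longrightarrow> x \<in> X \<Longrightarrow> vtx G lam x \<in> verts G"
  by (meson bij_betwE bij_betw_vtx)

lemma lam_mem: "bij_betw lam (verts G) X \<Longrightarrow> v \<in> verts G \<Longrightarrow> lam v \<in> X"
  by (meson bij_betwE)

lemma label_edges_iff:
  assumes "bij_betw lam (verts G) X" "u \<in> verts G" "v \<in> verts G"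
  shows "{lam u, lam v} \<in> label_edges G X lam \<longleftrightarrow> {u, v} \<in> edges G"
proof
  assume "{lam u, lam v} \<in> label_edges G X lam"
  then show "{u, v} \<in> edges G"
    using assms by (auto simp: label_edges_def doubleton_eq_iff vtx_lam insert_commute)
next
  assume "{u, v} \<in> edges G"
  then show "{lam u, lam v} \<in> label_edges G X lam"
    unfolding label_edges_def using assms
    by (intro CollectI exI[of _ "lam u"] exI[of _ "lam v"]) (simp add: vtx_lam lam_mem)
qed

lemma relabel_mem:
  assumes "bij_betw lam (verts G) X" "p permutes verts G"
  shows "relabel G X lam p \<in> Bij X"
proof -
  have "bij_betw (lam \<circ> (p \<circ> vtx G lam)) X X"
    using bij_betw_trans[OF bij_betw_trans[OF bij_betw_vtx[OF assms(1)] permutes_imp_bij[OF assms(2)]] assms(1)] .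
  then show ?thesis
    by (auto simp: Bij_def relabel_def cong: bij_betw_cong)
qed

lemma relabel_iso:
  assumes bij: "bij_betw lam (verts G) X"
  shows "relabel G X lam \<in> iso (perm_group (verts G)) (BijGroup X)"
proof -
  let ?r = "relabel G X lam"
  have hom: "?r \<in> hom (perm_group (verts G)) (BijGroup X)"
  proof (rule homI)
    fix p q assume "p \<in> carrier (perm_group (verts G))" "q \<in> carrier (perm_group (verts G))"
    then have p: "p permutes verts G" and q: "q permutes verts G" by auto
    have "?r (p \<circ> q) = compose X (?r p) (?r q)"
      using bij q
      by (auto simp: relabel_def compose_def fun_eq_iff vtx_lam vtx_mem lam_mem permutes_in_image)
    then show "?r (p \<otimes>\<^bsub>perm_group (verts G)\<^esub> q) = ?r p \<otimes>\<^bsub>BijGroup X\<^esub> ?r q"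
      using relabel_mem[OF bij p] relabel_mem[OF bij q] by (simp add: BijGroup_def)
  qed (use relabel_mem[OF bij] in \<open>auto simp: BijGroup_def\<close>)
  moreover have "inj_on ?r {p. p permutes verts G}"
  proof (rule inj_onI, rule ext)
    fix p q v assume pq: "p \<in> {p. p permutes verts G}" "q \<in> {p. p permutes verts G}" "?r p = ?r q"
    show "p v = q v"
    proof (cases "v \<in> verts G")
      case True
      then have "?r p (lam v) = lam (p v)" "?r q (lam v) = lam (q v)"
        using bij by (auto simp: relabel_def vtx_lam lam_mem)
      then show ?thesis
        using pq True bij by (metis mem_Collect_eq permutes_in_image vtx_lam)
    next
      case False
      then show ?thesis using pq by (simp add: permutes_not_in)
    qed
  qed
  moreover have "\<sigma> \<in> ?r ` {p. p permutes verts G}" if "\<sigma> \<in> Bij X" for \<sigma>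
  proof
    \<comment> \<open>The preimage of \<open>\<sigma>\<close> is its conjugate by the labeling,
      extended by the identity as \<open>permutes\<close> demands.\<close>
    let ?p = "\<lambda>v. if v \<in> verts G then vtx G lam (\<sigma> (lam v)) else v"
    have "bij_betw (vtx G lam \<circ> (\<sigma> \<circ> lam)) (verts G) (verts G)"
      using that bij_betw_trans[OF bij_betw_trans[OF bij] bij_betw_vtx[OF bij]]
      by (auto simp: Bij_def comp_assoc)
    then have "bij_betw ?p (verts G) (verts G)"
      by (auto cong: bij_betw_cong)
    then show "?p \<in> {p. p permutes verts G}"
      by (auto intro: bij_imp_permutes)
    show "\<sigma> = ?r ?p"
      using that bij Bij_imp_funcset[OF that]
      by (auto simp: relabel_def fun_eq_iff Bij_def extensional_def lam_vtx vtx_mem Pi_iff)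
  qed
  ultimately show ?thesis
    using relabel_mem[OF bij]
    by (auto simp: iso_def bij_betw_def BijGroup_def)
qed

text \<open>A pair is an edge of the permuted graph when its image is an edge of \<open>G\<close>,
  hence a preimage of the edge set and not an image.\<close>

lemma permuted_graph_relabel:
  assumes G: "simple_graph G" and bij: "bij_betw lam (verts G) X" and p: "p permutes verts G"
  shows "permuted_graph G X lam (relabel G X lam p) = \<lparr>verts = verts G, edges = (`) p -` edges G\<rparr>"
proof -
  let ?\<sigma> = "relabel G X lam p"
  have *: "{?\<sigma> i, ?\<sigma> j} \<in> label_edges G X lam \<longleftrightarrow> {p (vtx G lam i), p (vtx G lam j)} \<in> edges G"
    if "i \<in> X" "j \<in> X" for i j
    using that label_edges_iff[OF bij, of "p (vtx G lam i)" "p (vtx G lam j)"] vtx_mem[OF bij]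
    by (simp add: relabel_def permutes_in_image[OF p])
  have "e \<in> {{vtx G lam i, vtx G lam j} | i j. i \<in> X \<and> j \<in> X \<and> {?\<sigma> i, ?\<sigma> j} \<in> label_edges G X lam}"
    if e: "p ` e \<in> edges G" for e
  proof -
    obtain u v where uv: "u \<in> verts G" "v \<in> verts G" "p ` e = {u, v}"
      using edgeE[OF G e] by metis
    \<comment> \<open>A set in the preimage is not known to consist of vertices; pulling its image
      edge back along \<open>inv p\<close> shows that it is a pair of them.\<close>
    then have "e = {inv p u, inv p v}"
      by (metis image_empty image_insert image_inv_f_f permutes_inj[OF p])
    moreover have "inv p u \<in> verts G" "inv p v \<in> verts G"
      using uv by (simp_all add: permutes_in_image[OF permutes_inv[OF p]])
    ultimately show ?thesis
      using e * vtx_lam[OF bij] lam_mem[OF bij]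
      by (intro CollectI exI[of _ "lam (inv p u)"] exI[of _ "lam (inv p v)"]) auto
  qed
  then show ?thesis
    unfolding permuted_graph_def using * by auto
qed

section \<open>Translation of \<open>Aut\<close> and \<open>all_Fer_perms\<close> by counting
  edges\<close>

lemma finite_card_vimage_edges:
  assumes "simple_graph G" "bij p"
  shows "finite ((`) p -` edges G)" "card ((`) p -` edges G) = card (edges G)"
proof -
  have "inj ((`) p)" using bij_is_inj[OF assms(2)] by (simp add: inj_def inj_image_eq_iff)
  moreover have "range ((`) p) = UNIV"
    using bij_is_surj[OF assms(2)] by (metis surj_def surj_image_vimage_eq)
  ultimately show "finite ((`) p -` edges G)" "card ((`) p -` edges G) = card (edges G)"
    using finite_edges[OF assms(1)] by (simp_all add: finite_vimageI card_vimage_inj)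
qed

text \<open>The edge set and its preimage are finite of equal size, so inclusion of one in the other
  is already equality.\<close>

lemma Aut_relabel_iff:
  assumes G: "simple_graph G" and bij: "bij_betw lam (verts G) X" and p: "p permutes verts G"
  shows "relabel G X lam p \<in> Aut G X lam \<longleftrightarrow> automorphism G p"
proof -
  have "(`) p -` edges G = edges G" if "edges G \<subseteq> (`) p -` edges G"
    using card_subset_eq[OF _ that] finite_card_vimage_edges[OF G permutes_bij[OF p]] by simp
  then have "(`) p -` edges G = edges G \<longleftrightarrow> (\<forall>e\<in>edges G. p ` e \<in> edges G)"
    by auto
  moreover have "\<lparr>verts = verts G, edges = E\<rparr> = G \<longleftrightarrow> E = edges G" for E
    by (cases G) simp
  ultimately show ?thesis
    using relabel_mem[OF bij p] p
    by (simp add: Aut_def BijGroup_def permuted_graph_relabel[OF assms] automorphism_def)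
qed

text \<open>From left to right, the removed edge is the exception. Conversely, the preimage of the
  edge set contains all edges but one and has the same size, so it arises by exchanging that edge
  for exactly one other pair.\<close>

lemma all_Fer_perms_relabel_iff:
  assumes G: "simple_graph G" and bij: "bij_betw lam (verts G) X" and p: "p permutes verts G"
  shows "relabel G X lam p \<in> all_Fer_perms G X lam \<longleftrightarrow> near_automorphism G p"
proof
  assume "relabel G X lam p \<in> all_Fer_perms G X lam"
  then obtain \<rho> where \<rho>: "\<rho> \<in> feasible_replacements G X lam" "relabel G X lam p \<in> Fer_perms G X lam \<rho>"
    by (auto simp: all_Fer_perms_def)
  show "near_automorphism G p"
  proof (cases \<rho>)
    case Neutral
    then show ?thesis using \<rho> Aut_relabel_iff[OF assms] automorphism_imp_near by auto
  next
    case (Replace e e')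
    then have "(`) p -` edges G = edges G - {vtx G lam ` e} \<union> {vtx G lam ` e'}"
      using \<rho> by (auto simp: permuted_graph_relabel[OF assms] replace_edge_def)
    then have "\<forall>d\<in>edges G. d \<noteq> vtx G lam ` e \<longrightarrow> p ` d \<in> edges G"
      by blast
    then show ?thesis using p by (auto simp: near_automorphism_def)
  qed
next
  assume near: "near_automorphism G p"
  show "relabel G X lam p \<in> all_Fer_perms G X lam"
  proof (cases "automorphism G p")
    case True
    then show ?thesis
      using Aut_relabel_iff[OF assms]
      by (auto simp: all_Fer_perms_def feasible_replacements_def intro!: bexI[of _ Neutral])
  next
    case False
    then obtain f where f: "f \<in> edges G" "p ` f \<notin> edges G"
      and fE: "\<And>d. d \<in> edges G \<Longrightarrow> d \<noteq> f \<Longrightarrow> p ` d \<in> edges G"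
      using near p by (metis automorphism_def near_automorphism_def)
    let ?E = "(`) p -` edges G"
    have card: "card ?E = card (edges G)"
      by (rule finite_card_vimage_edges(2)[OF G permutes_bij[OF p]])
    have sub: "edges G - {f} \<subseteq> ?E" using fE by auto
    have "card (edges G) = Suc (card (edges G - {f}))"
      using f finite_edges[OF G] by (metis card.remove)
    then have "card (?E - (edges G - {f})) = 1"
      using card card_Diff_subset[OF _ sub] finite_edges[OF G] by simp
    then obtain f' where f': "?E - (edges G - {f}) = {f'}"
      by (auto simp: card_1_singleton_iff)
    then have E: "?E = edges G - {f} \<union> {f'}" using sub by auto
    \<comment> \<open>\<open>p\<close> sends \<open>f'\<close> to an edge but \<open>f\<close> to a
      non-edge. Being outside \<open>edges G - {f}\<close>, the set \<open>f'\<close> is then no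
      edge of \<open>G\<close>.\<close>
    have "f' \<noteq> f" using f' f by auto
    then have f'E: "f' \<notin> edges G" "p ` f' \<in> edges G" using f' by auto
    obtain a b where ab: "a \<in> verts G" "b \<in> verts G" "a \<noteq> b" "f = {a, b}"
      using edgeE[OF G f(1)] .
    obtain c' d' where cd': "c' \<in> verts G" "d' \<in> verts G" "c' \<noteq> d'" "p ` f' = {c', d'}"
      using edgeE[OF G f'E(2)] .
    define c d where "c = inv p c'" and "d = inv p d'"
    have cd: "c \<in> verts G" "d \<in> verts G" "c \<noteq> d"
      using cd' permutes_inj[OF permutes_inv[OF p]]
      by (auto simp: c_def d_def permutes_in_image[OF permutes_inv[OF p]] inj_eq)
    have f'cd: "f' = {c, d}"
      using cd'(4) by (metis c_def d_def image_empty image_insert image_inv_f_f permutes_inj[OF p])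
    let ?e = "lam ` f" and ?e' = "lam ` f'"
    have ve: "vtx G lam ` ?e = f" "vtx G lam ` ?e' = f'"
      using ab cd f'cd by (simp_all add: vtx_lam[OF bij])
    have e: "?e \<in> label_edges G X lam"
      using ab f label_edges_iff[OF bij, of a b] by simp
    have "{c, d} \<in> edges (complement_graph G)"
      using cd f'E f'cd by (auto simp: complement_graph_def)
    then have "?e' \<in> label_edges (complement_graph G) X lam"
      using cd f'cd label_edges_iff[of lam "complement_graph G" X c d] bij
      by (simp add: complement_graph_def)
    moreover have rg: "replace_edge G lam ?e ?e' = \<lparr>verts = verts G, edges = ?E\<rparr>"
      unfolding replace_edge_def ve E ..
    \<comment> \<open>The isomorphism is \<open>p\<close> itself, since the new edge set is the
      preimage of the old one under \<open>p\<close>.\<close>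
    then have "graph_isomorphic (replace_edge G lam ?e ?e') G"
      unfolding graph_isomorphic_def using permutes_imp_bij[OF p] by auto
    ultimately have "feasible G X lam ?e ?e'"
      using e by (auto simp: feasible_def edge_replacement_def)
    moreover have "?e \<noteq> ?e'" using ve \<open>f' \<noteq> f\<close> by metis
    ultimately have "Replace ?e ?e' \<in> feasible_replacements G X lam"
      by (auto simp: feasible_replacements_def)
    moreover have "relabel G X lam p \<in> Fer_perms G X lam (Replace ?e ?e')"
      using relabel_mem[OF bij p] by (simp add: rg permuted_graph_relabel[OF assms] BijGroup_def)
    ultimately show ?thesis unfolding all_Fer_perms_def by blast
  qed
qed

text \<open>An isomorphism maps the subgroup generated by a set onto the subgroup generated by its
  image, and injectivity on the carrier allows the comparison to be pulled back.\<close>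

lemma generate_relabel_eq_carrier_iff:
  assumes bij: "bij_betw lam (verts G) X" and S: "S \<subseteq> carrier (BijGroup X)"
  shows "generate (BijGroup X) S = carrier (BijGroup X) \<longleftrightarrow>
    generate (perm_group (verts G)) {p. p permutes verts G \<and> relabel G X lam p \<in> S}
      = carrier (perm_group (verts G))"
proof -
  let ?r = "relabel G X lam" and ?P = "perm_group (verts G)"
  let ?T = "{p. p permutes verts G \<and> ?r p \<in> S}"
  interpret group_hom ?P "BijGroup X" ?r
    using relabel_iso[OF bij] group_perm_group group_BijGroup
    by (auto simp: group_hom_def group_hom_axioms_def iso_def)
  have inj: "inj_on ?r (carrier ?P)" and img: "?r ` carrier ?P = carrier (BijGroup X)"
    using relabel_iso[OF bij] by (auto simp: iso_def bij_betw_def)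
  have "?r ` ?T = S"
  proof (intro equalityI subsetI)
    fix s assume "s \<in> S"
    with S img have "s \<in> ?r ` carrier ?P" by auto
    with \<open>s \<in> S\<close> show "s \<in> ?r ` ?T" by auto
  qed auto
  moreover have T: "?T \<subseteq> carrier ?P" by auto
  ultimately have "generate (BijGroup X) S = ?r ` generate ?P ?T"
    using generate_img[OF T] by simp
  then show ?thesis
    using inj_on_image_eq_iff[OF inj G.generate_incl[OF T] subset_refl] img by simp
qed

lemma all_Fer_perms_subset: "all_Fer_perms G X lam \<subseteq> carrier (BijGroup X)"
proof -
  have "Fer_perms G X lam \<rho> \<subseteq> carrier (BijGroup X)" for \<rho>
    by (cases \<rho>) (auto simp: Aut_def)
  then show ?thesis by (auto simp: all_Fer_perms_def)
qed

lemma local_amoeba_iff: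
  assumes G: "simple_graph G" and bij: "bij_betw lam (verts G) X"
  shows "local_amoeba G X lam \<longleftrightarrow>
    generate (perm_group (verts G)) {p. near_automorphism G p} = carrier (perm_group (verts G))"
proof -
  have "{p. p permutes verts G \<and> relabel G X lam p \<in> all_Fer_perms G X lam} = {p. near_automorphism G p}"
    using all_Fer_perms_relabel_iff[OF assms] by (auto simp: near_automorphism_def)
  then show ?thesis
    using generate_relabel_eq_carrier_iff[OF bij all_Fer_perms_subset[of G X lam]]
    by (simp add: local_amoeba_def Fer_group_def)
qed

lemma hang_symmetric_at_iff:
  assumes G: "simple_graph G" and bij: "bij_betw lam (verts G) X" and v: "v \<in> verts G"
  shows "hang_symmetric_at G X lam v \<longleftrightarrow>
    generate (perm_group (verts G)) {p. near_automorphism G p \<and> p v = v \<or> automorphism G p}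
      = carrier (perm_group (verts G))"
proof -
  let ?S = "{\<sigma> \<in> all_Fer_perms G X lam. \<sigma> (lam v) = lam v} \<union> Aut G X lam"
  have fix_iff: "relabel G X lam p (lam v) = lam v \<longleftrightarrow> p v = v" if "p permutes verts G" for p
    using that v bij vtx_lam[OF bij]
    by (simp add: relabel_def lam_mem) (metis permutes_in_image)
  have "{p. p permutes verts G \<and> relabel G X lam p \<in> ?S}
      = {p. near_automorphism G p \<and> p v = v \<or> automorphism G p}"
    using all_Fer_perms_relabel_iff[OF G bij] Aut_relabel_iff[OF G bij] fix_iff
    by (auto simp: near_automorphism_def automorphism_def)
  moreover have "?S \<subseteq> carrier (BijGroup X)"
    using all_Fer_perms_subset by (fastforce simp: Aut_def)
  ultimately show ?thesis
    using generate_relabel_eq_carrier_iff[OF bij, of ?S]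
    by (simp add: hang_symmetric_at_def hang_group_def)
qed


section \<open>Permutations of the comb product\<close>

lemma verts_comb_product [simp]: "verts (comb_product G H r) = verts G \<times> verts H"
  by (simp add: comb_product_def)

text \<open>Edges are written as images of whole edges of the factors, so that the image under a
  lifted permutation can be computed without choosing endpoints.\<close>

lemma edges_comb_product:
  assumes "simple_graph G" "simple_graph H"
  shows "edges (comb_product G H r) =
    (\<lambda>f. (\<lambda>x. (x, r)) ` f) ` edges G \<union> {Pair u ` e | u e. u \<in> verts G \<and> e \<in> edges H}"
proof -
  have "{{(u, r), (u', r)} | u u'. {u, u'} \<in> edges G} = (\<lambda>f. (\<lambda>x. (x, r)) ` f) ` edges G"
  proof (intro equalityI subsetI)
    fix d assume "d \<in> (\<lambda>f. (\<lambda>x. (x, r)) ` f) ` edges G"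
    then obtain f where f: "f \<in> edges G" "d = (\<lambda>x. (x, r)) ` f" by auto
    obtain u v where "f = {u, v}" using edgeE[OF assms(1) f(1)] .
    then show "d \<in> {{(u, r), (u', r)} | u u'. {u, u'} \<in> edges G}" using f by auto
  next
    fix d assume "d \<in> {{(u, r), (u', r)} | u u'. {u, u'} \<in> edges G}"
    then obtain u u' where "d = (\<lambda>x. (x, r)) ` {u, u'}" "{u, u'} \<in> edges G" by auto
    then show "d \<in> (\<lambda>f. (\<lambda>x. (x, r)) ` f) ` edges G" by (rule image_eqI)
  qed
  moreover have "{{(u, w), (u, w')} | u w w'. u \<in> verts G \<and> {w, w'} \<in> edges H}
    = {Pair u ` e | u e. u \<in> verts G \<and> e \<in> edges H}"
  proof (intro equalityI subsetI)
    fix d assume "d \<in> {Pair u ` e | u e. u \<in> verts G \<and> e \<in> edges H}"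
    then obtain u e where e: "e \<in> edges H" "d = Pair u ` e" "u \<in> verts G" by auto
    obtain w w' where "e = {w, w'}" using edgeE[OF assms(2) e(1)] .
    then show "d \<in> {{(u, w), (u, w')} | u w w'. u \<in> verts G \<and> {w, w'} \<in> edges H}"
      using e by auto
  next
    fix d assume "d \<in> {{(u, w), (u, w')} | u w w'. u \<in> verts G \<and> {w, w'} \<in> edges H}"
    then obtain u w w' where "d = Pair u ` {w, w'}" "u \<in> verts G" "{w, w'} \<in> edges H" by auto
    then show "d \<in> {Pair u ` e | u e. u \<in> verts G \<and> e \<in> edges H}" by blast
  qed
  ultimately show ?thesis by (simp add: comb_product_def)
qed

lemma comb_product_base_edge:
  assumes "simple_graph G" "simple_graph H" "e \<in> edges G"
  shows "(\<lambda>x. (x, r)) ` e \<in> edges (comb_product G H r)"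
  using assms(3) unfolding edges_comb_product[OF assms(1,2)] by blast

lemma comb_product_fibre_edge:
  assumes "simple_graph G" "simple_graph H" "x \<in> verts G" "e \<in> edges H"
  shows "Pair x ` e \<in> edges (comb_product G H r)"
  using assms(3,4) unfolding edges_comb_product[OF assms(1,2)] by blast

lemma comb_product_edge_cases:
  assumes "simple_graph G" "simple_graph H" "d \<in> edges (comb_product G H r)"
  obtains (base) e where "e \<in> edges G" "d = (\<lambda>x. (x, r)) ` e"
    | (fibre) x e where "x \<in> verts G" "e \<in> edges H" "d = Pair x ` e"
  using assms(3) unfolding edges_comb_product[OF assms(1,2)] by blast

section \<open>Lifts of permutations of the factors to the product\<close>

lemma permutes_inverseI:
  assumes "\<And>x. p (q x) = x" "\<And>x. q (p x) = x" "\<And>x. x \<notin> S \<Longrightarrow> p x = x"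
  shows "p permutes S"
  unfolding permutes_def using assms by metis

text \<open>The set \<open>W\<close> serves two purposes: with all vertices of \<open>H\<close>
  whole fibres are permuted, and with a set avoiding the root only a detached piece of each fibre
  moves.\<close>

definition lift_base :: "('v \<Rightarrow> 'v) \<Rightarrow> 'w set \<Rightarrow> 'v \<times> 'w \<Rightarrow> 'v \<times> 'w" where
  "lift_base p W = (\<lambda>(x, y). if y \<in> W then (p x, y) else (x, y))"

definition lift_fibre :: "'v \<Rightarrow> ('w \<Rightarrow> 'w) \<Rightarrow> 'v \<times> 'w \<Rightarrow> 'v \<times> 'w" where
  "lift_fibre u p = (\<lambda>(x, y). if x = u then (x, p y) else (x, y))"

lemma lift_base_permutes:
  assumes "p permutes V" "C \<subseteq> W"
  shows "lift_base p C permutes (V \<times> W)"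
proof (rule permutes_inverseI)
  show "lift_base p C (lift_base (inv p) C x) = x" "lift_base (inv p) C (lift_base p C x) = x" for x
    using permutes_inverses[OF assms(1)] by (auto simp: lift_base_def split: prod.splits)
  show "lift_base p C x = x" if "x \<notin> V \<times> W" for x
    using that assms permutes_not_in[OF assms(1)] by (auto simp: lift_base_def split: prod.splits)
qed

lemma lift_fibre_permutes:
  assumes "p permutes W" "u \<in> V"
  shows "lift_fibre u p permutes (V \<times> W)"
proof (rule permutes_inverseI)
  show "lift_fibre u p (lift_fibre u (inv p) x) = x" "lift_fibre u (inv p) (lift_fibre u p x) = x" for x
    using permutes_inverses[OF assms(1)] by (auto simp: lift_fibre_def split: prod.splits)
  show "lift_fibre u p x = x" if "x \<notin> V \<times> W" for x
    using that assms permutes_not_in[OF assms(1)] by (auto simp: lift_fibre_def split: prod.splits)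
qed

lemma lift_base_hom:
  "group_hom (perm_group V) (perm_group (V \<times> W)) (\<lambda>p. lift_base p W)"
  by (auto simp: group_hom_def group_hom_axioms_def group_perm_group hom_def lift_base_permutes)
    (auto simp: lift_base_def fun_eq_iff)

lemma lift_fibre_hom:
  "u \<in> V \<Longrightarrow> group_hom (perm_group W) (perm_group (V \<times> W)) (lift_fibre u)"
  by (auto simp: group_hom_def group_hom_axioms_def group_perm_group hom_def lift_fibre_permutes)
    (auto simp: lift_fibre_def fun_eq_iff)

lemma lift_fibre_transpose:
  "lift_fibre u (transpose a b) = transpose (u, a) (u, b)"
  by (auto simp: lift_fibre_def fun_eq_iff transpose_def)

text \<open>Reduces a claim about lifts of all permutations to a check on generators.\<close>

lemma (in group_hom) image_generate_subset:
  assumes "S \<subseteq> carrier G" "h ` S \<subseteq> T" "generate G S = carrier G"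
  shows "h ` carrier G \<subseteq> generate H T"
  using generate_img[OF assms(1)] H.mono_generate[OF assms(2)] assms(3) by simp

text \<open>Fibre edges go to the same edge of \<open>H\<close> in another fibre, so only the base
  copy of the exceptional edge can be lost.\<close>

lemma near_automorphism_lift_base:
  assumes G: "simple_graph G" and H: "simple_graph H" and r: "r \<in> verts H"
    and near: "near_automorphism G p"
  shows "near_automorphism (comb_product G H r) (lift_base p (verts H))"
proof -
  have p: "p permutes verts G" using near by (simp add: near_automorphism_def)
  obtain f where f: "\<And>e. e \<in> edges G \<Longrightarrow> e \<noteq> f \<Longrightarrow> p ` e \<in> edges G"
    using near by (auto simp: near_automorphism_def)
  have lift_root: "lift_base p (verts H) ` (\<lambda>x. (x, r)) ` e = (\<lambda>x. (x, r)) ` (p ` e)" for e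
    using r by (auto simp: lift_base_def image_image)
  have lift_Pair: "lift_base p (verts H) ` Pair u ` e = Pair (p u) ` e" if "e \<in> edges H" for u e
    unfolding image_image using edge_verts[OF H that] by (intro image_cong) (auto simp: lift_base_def)
  have "lift_base p (verts H) ` d \<in> edges (comb_product G H r)"
    if "d \<in> edges (comb_product G H r)" "d \<noteq> (\<lambda>x. (x, r)) ` f" for d
    using G H that(1)
  proof (cases rule: comb_product_edge_cases)
    case (base e)
    then have "p ` e \<in> edges G" using f that(2) by blast
    then show ?thesis
      unfolding base(2) lift_root by (rule comb_product_base_edge[OF G H])
  next
    case (fibre x e)
    then have "p x \<in> verts G" by (simp add: permutes_in_image[OF p])
    then show ?thesis
      unfolding fibre(3) lift_Pair[OF fibre(2)] using fibre(2) by (rule comb_product_fibre_edge[OF G H])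
  qed
  then show ?thesis
    using lift_base_permutes[OF p subset_refl] by (auto simp: near_automorphism_def)
qed

lemma lift_fibre_image_Pair:
  "lift_fibre u p ` Pair x ` e = (if x = u then Pair x ` (p ` e) else Pair x ` e)"
  by (auto simp: lift_fibre_def image_image)

text \<open>As \<open>p\<close> fixes the root, no endpoint of a base edge moves; only the copy of
  the exceptional edge over \<open>u\<close> can be lost.\<close>

lemma near_automorphism_lift_fibre:
  assumes G: "simple_graph G" and H: "simple_graph H" and u: "u \<in> verts G"
    and near: "near_automorphism H p" "p r = r"
  shows "near_automorphism (comb_product G H r) (lift_fibre u p)"
proof -
  have p: "p permutes verts H" using near by (simp add: near_automorphism_def)
  obtain f where f: "\<And>e. e \<in> edges H \<Longrightarrow> e \<noteq> f \<Longrightarrow> p ` e \<in> edges H"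
    using near by (auto simp: near_automorphism_def)
  have lift_root: "lift_fibre u p ` (\<lambda>x. (x, r)) ` e = (\<lambda>x. (x, r)) ` e" for e
    using near by (auto simp: lift_fibre_def image_image)
  have "lift_fibre u p ` d \<in> edges (comb_product G H r)"
    if "d \<in> edges (comb_product G H r)" "d \<noteq> Pair u ` f" for d
    using G H that(1)
  proof (cases rule: comb_product_edge_cases)
    case (base e)
    then show ?thesis
      unfolding base(2) lift_root by (intro comb_product_base_edge[OF G H])
  next
    case (fibre x e)
    show ?thesis
    proof (cases "x = u")
      case True
      then have "p ` e \<in> edges H" using f fibre that(2) by blast
      then show ?thesis
        using True fibre by (simp add: lift_fibre_image_Pair comb_product_fibre_edge[OF G H])
    next
      case False
      then show ?thesis
        using fibre by (simp add: lift_fibre_image_Pair comb_product_fibre_edge[OF G H])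
    qed
  qed
  then show ?thesis
    using lift_fibre_permutes[OF p u] by (auto simp: near_automorphism_def)
qed

text \<open>Here \<open>p\<close> may move the root, which endangers the base edges at
  \<open>u\<close>. A leaf has only one, and all fibre edges survive because \<open>p\<close> is an
  automorphism.\<close>

lemma near_automorphism_lift_fibre_leaf:
  assumes G: "simple_graph G" and H: "simple_graph H" and u: "leaf G u"
    and aut: "automorphism H p"
  shows "near_automorphism (comb_product G H r) (lift_fibre u p)"
proof -
  have p: "p permutes verts H" and pE: "\<And>e. e \<in> edges H \<Longrightarrow> p ` e \<in> edges H"
    using aut by (auto simp: automorphism_def)
  have uV: "u \<in> verts G" using u by (simp add: leaf_def)
  obtain f where f: "{e \<in> edges G. u \<in> e} = {f}"
    using u by (auto simp: leaf_def degree_def card_1_singleton_iff)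
  have lift_root: "lift_fibre u p ` (\<lambda>x. (x, r)) ` e = (\<lambda>x. (x, r)) ` e" if "e \<in> edges G" "e \<noteq> f" for e
  proof -
    have "u \<notin> e" using that f by auto
    then show ?thesis unfolding image_image by (intro image_cong) (auto simp: lift_fibre_def)
  qed
  have "lift_fibre u p ` d \<in> edges (comb_product G H r)"
    if "d \<in> edges (comb_product G H r)" "d \<noteq> (\<lambda>x. (x, r)) ` f" for d
    using G H that(1)
  proof (cases rule: comb_product_edge_cases)
    case (base e)
    then have "lift_fibre u p ` d = d" using lift_root[of e] that(2) by blast
    then show ?thesis using that(1) by simp
  next
    case (fibre x e)
    then show ?thesis
      using pE[of e] uV by (auto simp: lift_fibre_image_Pair comb_product_fibre_edge[OF G H])
  qed
  then show ?thesis
    using lift_fibre_permutes[OF p uV] by (auto simp: near_automorphism_def)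
qed

text \<open>\<open>C\<close> is a union of components of \<open>H\<close> without the root, so its
  copies are interchangeable by any permutation \<open>p\<close> whatever the edges of
  \<open>G\<close>: base edges stay fixed, and a fibre edge either lies in \<open>C\<close> and
  moves to another fibre or stays.\<close>

lemma automorphism_lift_base_closed:
  assumes G: "simple_graph G" and H: "simple_graph H" and p: "p permutes verts G"
    and C: "C \<subseteq> verts H" "r \<notin> C"
    and closed: "\<And>e. e \<in> edges H \<Longrightarrow> e \<subseteq> C \<or> e \<inter> C = {}"
  shows "automorphism (comb_product G H r) (lift_base p C)"
proof -
  have lift_root: "lift_base p C ` (\<lambda>x. (x, r)) ` e = (\<lambda>x. (x, r)) ` e" for e
    using C by (auto simp: lift_base_def image_image)
  have lift_Pair: "lift_base p C ` Pair u ` e = (if e \<subseteq> C then Pair (p u) ` e else Pair u ` e)"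
    if "e \<in> edges H" for u e
    unfolding image_image using closed[OF that]
    by (auto simp: lift_base_def intro!: image_cong)
  have "lift_base p C ` d \<in> edges (comb_product G H r)"
    if "d \<in> edges (comb_product G H r)" for d
    using G H that
  proof (cases rule: comb_product_edge_cases)
    case (base e)
    then show ?thesis
      unfolding base(2) lift_root by (intro comb_product_base_edge[OF G H])
  next
    case (fibre x e)
    then show ?thesis
      by (simp add: lift_Pair permutes_in_image[OF p] comb_product_fibre_edge[OF G H])
  qed
  then show ?thesis
    using lift_base_permutes[OF p C(1)] by (auto simp: automorphism_def)
qed

lemma disconnected_closed_set:
  assumes H: "simple_graph H" and "\<not> connected_graph H" and r: "r \<in> verts H"
  obtains C c where "C \<subseteq> verts H" "r \<notin> C" "c \<in> C" "\<And>e. e \<in> edges H \<Longrightarrow> e \<subseteq> C \<or> e \<inter> C = {}"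
proof -
  let ?R = "{(a, b). {a, b} \<in> edges H}"
  \<comment> \<open>The vertices not reachable from \<open>r\<close>. If this set were empty, any
    two vertices would be joined through \<open>r\<close> by symmetry.\<close>
  let ?C = "{w \<in> verts H. (r, w) \<notin> ?R\<^sup>*}"
  have sym: "sym (?R\<^sup>*)"
    by (intro sym_rtrancl) (auto simp: sym_def insert_commute)
  obtain a b where "a \<in> verts H" "b \<in> verts H" "(a, b) \<notin> ?R\<^sup>*"
    using assms(2) by (auto simp: connected_graph_def)
  then have "a \<in> ?C \<or> b \<in> ?C"
    using symD[OF sym, of r a] rtrancl_trans[of a r ?R b] by auto
  then obtain c where "c \<in> ?C" by auto
  moreover have "e \<subseteq> ?C \<or> e \<inter> ?C = {}" if e: "e \<in> edges H" for e
  proof -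
    obtain w w' where "w \<in> verts H" "w' \<in> verts H" "e = {w, w'}"
      using edgeE[OF H e] by metis
    moreover from this e have "(w, w') \<in> ?R" "(w', w) \<in> ?R"
      by (auto simp: insert_commute)
    ultimately show ?thesis
      using rtrancl_into_rtrancl[of r w ?R w'] rtrancl_into_rtrancl[of r w' ?R w] by auto
  qed
  ultimately show thesis using that[of ?C c] by auto
qed

section \<open>Transpositions of the product obtained from the lifts\<close>

theorem lemma7:
  fixes G :: "'v ugraph" and X :: "'x set" and lamG :: "'v \<Rightarrow> 'x"
    and H :: "'w ugraph" and Y :: "'y set" and lamH :: "'w \<Rightarrow> 'y" and root :: 'w
    and Z :: "'z set" and lam :: "'v \<times> 'w \<Rightarrow> 'z"
  assumes "labeled_graph G X lamG" and "local_amoeba G X lamG"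
    and "\<exists>v. leaf G v"
    and "labeled_graph H Y lamH" and "local_amoeba H Y lamH"
    and "root \<in> verts H" and "hang_symmetric_at H Y lamH root"
    and "\<not> connected_graph H"
    and "bij_betw lam (verts (comb_product G H root)) Z"
  shows "local_amoeba (comb_product G H root) Z lam"
proof -
  let ?V = "verts G" and ?W = "verts H" and ?P = "comb_product G H root"
  have G: "simple_graph G" "bij_betw lamG ?V X" and H: "simple_graph H" "bij_betw lamH ?W Y"
    using assms(1,4) by (auto simp: labeled_graph_def)
  have P: "simple_graph ?P" using simple_graph_comb_product[OF G(1) H(1) assms(6)] .
  obtain u where u: "leaf G u" using assms(3) by blast
  then have uV: "u \<in> ?V" by (simp add: leaf_def)
  \<comment> \<open>The vertex form of \<open>Fer_group\<close> for the product, by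
    \<open>local_amoeba_iff\<close>.\<close>
  define K where "K = generate (perm_group (?V \<times> ?W)) {p. near_automorphism ?P p}"
  have near_K: "p \<in> K" if "near_automorphism ?P p" for p
    unfolding K_def using that by (simp add: generate.incl)
  have sub: "subgroup K (perm_group (?V \<times> ?W))"
    unfolding K_def
    by (rule group.generate_is_subgroup[OF group_perm_group]) (auto simp: near_automorphism_def)

  have "(\<lambda>p. lift_base p ?W) ` carrier (perm_group ?V) \<subseteq> K"
    unfolding K_def
  proof (rule group_hom.image_generate_subset[OF lift_base_hom])
    show "{p. near_automorphism G p} \<subseteq> carrier (perm_group ?V)"
      by (auto simp: near_automorphism_def)
    show "(\<lambda>p. lift_base p ?W) ` {p. near_automorphism G p} \<subseteq> {p. near_automorphism ?P p}"
      using near_automorphism_lift_base[OF G(1) H(1) assms(6)] by auto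
    show "generate (perm_group ?V) {p. near_automorphism G p} = carrier (perm_group ?V)"
      using assms(2) by (simp only: local_amoeba_iff[OF G])
  qed
  then have base: "lift_base p ?W \<in> K" if "p permutes ?V" for p
    using that by auto

  let ?S = "{p. near_automorphism H p \<and> p root = root \<or> automorphism H p}"
  have "lift_fibre u ` carrier (perm_group ?W) \<subseteq> K"
    unfolding K_def
  proof (rule group_hom.image_generate_subset[OF lift_fibre_hom[OF uV]])
    show "?S \<subseteq> carrier (perm_group ?W)"
      by (auto simp: near_automorphism_def automorphism_def)
    \<comment> \<open>The two kinds of generators of the hang group need different reasons: fixing
      the root for one, the leaf for the other.\<close>
    show "lift_fibre u ` ?S \<subseteq> {p. near_automorphism ?P p}"
      using near_automorphism_lift_fibre[OF G(1) H(1) uV]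
        near_automorphism_lift_fibre_leaf[OF G(1) H(1) u] by auto
    show "generate (perm_group ?W) ?S = carrier (perm_group ?W)"
      using assms(7) hang_symmetric_at_iff[OF H assms(6)] by simp
  qed
  then have leaf_fibre: "transpose (u, a) (u, b) \<in> K" if "a \<in> ?W" "b \<in> ?W" for a b
    using that permutes_swap_id[of a ?W b] by (auto simp flip: lift_fibre_transpose)

  \<comment> \<open>Conjugation by the lift of \<open>transpose u x\<close> carries the fibre over
    the leaf to the fibre over \<open>x\<close>.\<close>
  have fibre: "transpose (x, a) (x, b) \<in> K" if "x \<in> ?V" "a \<in> ?W" "b \<in> ?W" for x a b
    using transpose_conjugate_mem[OF sub base[OF permutes_swap_id[OF uV \<open>x \<in> ?V\<close>]]
        leaf_fibre[OF that(2,3)]] that(2,3)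
    by (simp add: lift_base_def)

  obtain C c where C: "C \<subseteq> ?W" "root \<notin> C" "c \<in> C"
    and closed: "\<And>e. e \<in> edges H \<Longrightarrow> e \<subseteq> C \<or> e \<inter> C = {}"
    using disconnected_closed_set[OF H(1) assms(8,6)] by metis
  then have cW: "c \<in> ?W" by auto
  have across: "transpose (y, c) (x, root) \<in> K" if "x \<in> ?V" "y \<in> ?V" for x y
  proof -
    \<comment> \<open>This element sends \<open>(x, c)\<close> to \<open>(y, c)\<close> but fixes
      \<open>(x, root)\<close>, so conjugating the transposition of these two points of one fibre
      yields the one across fibres.\<close>
    have "lift_base (transpose x y) C \<in> K"
      using that C closed
      by (intro near_K automorphism_imp_near automorphism_lift_base_closed[OF G(1) H(1)] permutes_swap_id) auto
    from transpose_conjugate_mem[OF sub this fibre[OF that(1) cW assms(6)]]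
    show ?thesis using C by (simp add: lift_base_def)
  qed

  have "transpose a b \<in> K" if mem: "a \<in> ?V \<times> ?W" "b \<in> ?V \<times> ?W" for a b
  proof -
    obtain x i y j where ab: "a = (x, i)" "b = (y, j)" "x \<in> ?V" "y \<in> ?V" "i \<in> ?W" "j \<in> ?W"
      using mem by auto
    show ?thesis
      \<comment> \<open>The chain runs \<open>(x, i)\<close>, \<open>(x, c)\<close>,
        \<open>(y, root)\<close>, \<open>(y, j)\<close>: within a fibre, across, within a
        fibre.\<close>
      unfolding ab(1,2)
      using transpose_trans_mem[OF sub fibre[OF ab(3,5) cW]
          transpose_trans_mem[OF sub across[OF ab(4,3)] fibre[OF ab(4) assms(6) ab(6)]]] .
  qed
  then have "K = carrier (perm_group (?V \<times> ?W))"
    using G(1) H(1) by (intro perm_group_subgroup_eq_carrier[OF sub]) (auto simp: simple_graph_def)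
  then show ?thesis
    using local_amoeba_iff[OF P assms(9)] by (simp add: K_def)
qed

end
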